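(* Let $G$ be a finite abelian group and let $a$ and $b$ be coprime integers (with $b \neq 0$) such that $|\mathrm{Aut}(G)|/|G| = a/b$. Then $b$ is squarefree.
   Context: $\mathrm{Aut}(G)$ denotes the group of automorphisms of the group $G$. An integer is squarefree if it is not divisible by the square of any prime; in particular $1$ is squarefree. *)

theory Defs
  imports "HOL-Algebra.Algebra" "HOL-Computational_Algebra.Squarefree"
begin

end

theory Submission
  imports Defs
begin

text \<open>
  Writing \<open>|Aut G| / |G|\<close> in lowest terms, a prime \<open>p\<close> divides the denominator at most once as soon as
  \<open>|Aut G|\<close> is divisible by all but one of the factors \<open>p\<close> of \<open>|G|\<close>. So the whole content is the
  statement \<open>prime_power_dvd_order_AutoGroup\<close>: if \<open>p ^ Suc n\<close> divides \<open>|G|\<close>, then \<open>p ^ n\<close> divides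
  \<open>|Aut G|\<close>. By Lagrange it suffices to find a subgroup of \<open>Aut G\<close> whose order is the order of the
  \<open>p\<close>-part \<open>P\<close> of \<open>G\<close> divided by \<open>p\<close>, and such a subgroup can be written down without decomposing \<open>G\<close>
  into cyclic factors.

  Let \<open>g\<close> have maximal order \<open>p ^ Suc e\<close> in \<open>P\<close>, let \<open>C\<close> be the cyclic group that it generates, and let
  \<open>x \<mapsto> x [^] m\<close> be the projection of \<open>G\<close> onto \<open>P\<close>. A homomorphism \<open>\<chi>\<close> from \<open>P\<close> to \<open>C\<close> gives the
  endomorphism \<open>x \<mapsto> x \<otimes> \<chi> (x [^] m)\<close>. Its kernel lies in \<open>C\<close>, where it is the power map with exponent
  \<open>1 + a\<close> if \<open>\<chi> g = g [^] a\<close>. Hence it is an automorphism whenever \<open>p\<close> divides \<open>a\<close>, that is, whenever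
  \<open>\<chi> g\<close> is a \<open>p\<close>-th power in \<open>C\<close>. These automorphisms are closed under composition, so they form a
  subgroup (\<open>card_characters_dvd_order_AutoGroup\<close>), and \<open>\<chi>\<close> can be recovered from its automorphism.

  It remains to see that there are \<open>|P| / p\<close> such \<open>\<chi>\<close> (\<open>card_characters\<close>). For \<open>P = C\<close> they
  correspond to the \<open>p\<close>-th powers in \<open>C\<close>, and there are \<open>p ^ e\<close> of them. Passing from a subgroup \<open>H\<close>
  to \<open>H\<close> with a further element \<open>x\<close> such that \<open>x [^] p\<close> is in \<open>H\<close>, an extension of \<open>\<chi>\<close> is the choice of a
  \<open>p\<close>-th root of \<open>\<chi> (x [^] p)\<close> in \<open>C\<close>. Since \<open>x [^] (p ^ Suc e)\<close> is trivial and \<open>C\<close> is cyclic of order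
  \<open>p ^ Suc e\<close>, there are exactly \<open>p\<close> such roots. So each step multiplies both the order of the subgroup
  and the number of homomorphisms by \<open>p\<close>.
\<close>

section \<open>Membership and closure criteria for subgroups\<close>

lemma (in group) coprime_pow_mem_imp_mem:
  assumes H: "subgroup H G" and x: "x \<in> carrier G"
    and "x [^] (m::nat) \<in> H" "x [^] (n::nat) \<in> H" "coprime m n"
  shows "x \<in> H"
proof (cases "m = 0")
  case True
  then show ?thesis using assms by auto
next
  case False
  then obtain u v where uv: "m * u = n * v + 1"
    using bezout_nat[of m n] \<open>coprime m n\<close> by auto
  have pow: "a [^] (k::nat) \<in> H" if "a \<in> H" for a k
    using that H by (induction k) (auto intro: subgroup.m_closed subgroup.one_closed)
  have "x [^] (n * v) \<otimes> x = x [^] (m * u)"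
    using x by (simp add: uv)
  also have "\<dots> \<in> H" using pow[OF assms(3), of u] x by (simp add: nat_pow_pow)
  finally have 1: "x [^] (n * v) \<otimes> x \<in> H" .
  have 2: "x [^] (n * v) \<in> H" using pow[OF assms(4), of v] x by (simp add: nat_pow_pow)
  have "x = inv (x [^] (n * v)) \<otimes> (x [^] (n * v) \<otimes> x)"
    using x by (simp add: m_assoc[symmetric])
  then show ?thesis
    using 1 2 H by (metis subgroup.m_closed subgroup.m_inv_closed)
qed

text \<open>
  Left multiplication by an element of the set is an injection of a finite set into itself, hence hits
  that element and then the identity; this produces the identity and the inverses.
\<close>

lemma (in group) subgroup_of_finite_closed:
  assumes "finite H" "H \<subseteq> carrier G" "H \<noteq> {}"
    and closed: "\<And>x y. x \<in> H \<Longrightarrow> y \<in> H \<Longrightarrow> x \<otimes> y \<in> H"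
  shows "subgroup H G"
proof (rule subgroupI)
  fix x assume x: "x \<in> H"
  have surj: "(\<lambda>y. x \<otimes> y) ` H = H"
  proof (rule endo_inj_surj[OF assms(1)])
    show "(\<lambda>y. x \<otimes> y) ` H \<subseteq> H" using closed x by blast
    show "inj_on (\<lambda>y. x \<otimes> y) H" using x assms(2) by (intro inj_onI) (auto simp: subset_iff)
  qed
  then obtain y where "y \<in> H" "x = x \<otimes> y" using x by (metis imageE)
  then have "\<one> \<in> H" using x assms(2) by (metis l_cancel_one' subsetD)
  then obtain z where z: "z \<in> H" "\<one> = x \<otimes> z" using surj by (metis imageE)
  have "x \<in> carrier G" "z \<in> carrier G" using x z(1) assms(2) by auto
  then have "z = inv x" using z(2) l_cancel[of x z "inv x"] by simp
  then show "inv x \<in> H" using z(1) by simp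
qed (use assms in auto)

section \<open>Roots in a cyclic group of prime power order\<close>

text \<open>
  The exponent is written as a successor because the group generated by \<open>g\<close> must be non-trivial: a
  trivial group has one \<open>p\<close>-th root of its identity instead of \<open>p\<close>.
\<close>

locale cyclic_p_subgroup = comm_group G for G (structure) +
  fixes p e :: nat and g
  assumes finite_carrier: "finite (carrier G)"
    and prime_p: "Factorial_Ring.prime p"
    and g_closed: "g \<in> carrier G"
    and ord_g: "ord g = p ^ Suc e"
begin

abbreviation C where "C \<equiv> generate G {g}"

lemma subgroup_C: "subgroup C G"
  by (rule generate_is_subgroup) (use g_closed in auto)

lemma C_closed: "c \<in> C \<Longrightarrow> c \<in> carrier G"
  using subgroup_C subgroup.mem_carrier by metis

lemma C_eq: "C = range (\<lambda>k::nat. g [^] k)"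
  using generate_pow_on_finite_carrier[OF finite_carrier g_closed] by auto

lemma finite_C: "finite C"
  using finite_carrier subgroup_C by (meson finite_subset subgroup.subset)

lemma g_in_C: "g \<in> C"
  by (simp add: generate.incl)

lemma pow_mem: "subgroup H G \<Longrightarrow> a \<in> H \<Longrightarrow> a [^] (k::nat) \<in> H"
  by (induction k) (auto intro: subgroup.m_closed subgroup.one_closed)

lemma g_pow_eq_one_iff: "g [^] k = \<one> \<longleftrightarrow> p ^ Suc e dvd k"
  using pow_eq_id[OF g_closed] ord_g by simp

lemma C_pow_eq_one: "c \<in> C \<Longrightarrow> c [^] (p ^ Suc e) = \<one>"
  by (auto simp: C_eq nat_pow_pow g_closed g_pow_eq_one_iff simp del: power_Suc)

lemma card_kernel_power_p: "card {c \<in> C. c [^] p = \<one>} = p"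
proof -
  have p0: "p > 0" using prime_p prime_gt_0_nat by blast
  have "{c \<in> C. c [^] p = \<one>} = (\<lambda>t. g [^] (t * p ^ e)) ` {..<p}"
  proof (intro equalityI subsetI)
    fix c assume c: "c \<in> {c \<in> C. c [^] p = \<one>}"
    then obtain k :: nat where k: "c = g [^] k" by (auto simp: C_eq)
    with c have "p ^ Suc e dvd k * p"
      by (simp add: nat_pow_pow g_closed g_pow_eq_one_iff del: power_Suc)
    then have "p ^ e dvd k" using p0 by (simp add: mult.commute)
    then obtain t where t: "k = t * p ^ e" by (metis dvd_def mult.commute)
    have "k = (t mod p + p * (t div p)) * p ^ e" using t by simp
    then have "k = t mod p * p ^ e + p ^ Suc e * (t div p)"
      by (simp only: distrib_left distrib_right power_Suc mult_ac)
    then have "c = g [^] (t mod p * p ^ e) \<otimes> g [^] (p ^ Suc e * (t div p))"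
      using k g_closed by (simp only: nat_pow_mult)
    also have "g [^] (p ^ Suc e * (t div p)) = \<one>"
      by (simp add: g_pow_eq_one_iff del: power_Suc)
    finally have "c = g [^] (t mod p * p ^ e)" using g_closed by simp
    then show "c \<in> (\<lambda>t. g [^] (t * p ^ e)) ` {..<p}" using p0 by auto
  next
    fix c assume "c \<in> (\<lambda>t. g [^] (t * p ^ e)) ` {..<p}"
    then show "c \<in> {c \<in> C. c [^] p = \<one>}"
      by (auto simp: C_eq nat_pow_pow g_closed g_pow_eq_one_iff mult.assoc)
  qed
  moreover have "inj_on (\<lambda>t. g [^] (t * p ^ e)) {..<p}"
  proof (rule inj_onI)
    fix s t assume st: "s \<in> {..<p}" "t \<in> {..<p}" "g [^] (s * p ^ e) = g [^] (t * p ^ e)"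
    have lt: "u * p ^ e \<le> ord g - 1" if "u < p" for u
    proof -
      have "u * p ^ e < ord g" using that p0 by (simp add: ord_g)
      then show ?thesis by linarith
    qed
    have "s * p ^ e = t * p ^ e"
      using inj_onD[OF ord_inj[OF g_closed] st(3)] lt st by auto
    then show "s = t" using p0 by simp
  qed
  ultimately show ?thesis by (simp add: card_image)
qed

text \<open>
  In a cyclic group of order \<open>p ^ Suc e\<close> the \<open>p\<close>-th powers are exactly the elements killed by \<open>p ^ e\<close>, so
  the hypothesis provides one root; the others differ from it by the kernel of the \<open>p\<close>-th power map.
\<close>

lemma card_pth_roots:
  assumes d: "d \<in> C" "d [^] (p ^ e) = \<one>"
  shows "card {c \<in> C. c [^] p = d} = p"
proof -
  have p0: "p > 0" using prime_p prime_gt_0_nat by blast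
  obtain k :: nat where k: "d = g [^] k" using d by (auto simp: C_eq)
  with d have "p ^ Suc e dvd k * p ^ e"
    by (simp add: nat_pow_pow g_closed g_pow_eq_one_iff del: power_Suc)
  then have "p dvd k" using p0 by simp
  then obtain j where j: "k = j * p" by (metis dvd_def mult.commute)
  define r where "r = g [^] j"
  have r: "r \<in> C" "r [^] p = d" using k j g_closed by (auto simp: r_def C_eq nat_pow_pow)
  note rc = C_closed[OF r(1)]
  have "bij_betw (\<lambda>c. r \<otimes> c) {c \<in> C. c [^] p = \<one>} {c \<in> C. c [^] p = d}"
  proof (rule bij_betw_byWitness[where f' = "\<lambda>c. inv r \<otimes> c"])
    show "\<forall>a\<in>{c \<in> C. c [^] p = \<one>}. inv r \<otimes> (r \<otimes> a) = a"
      "\<forall>a\<in>{c \<in> C. c [^] p = d}. r \<otimes> (inv r \<otimes> a) = a"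
      using rc by (auto simp: m_assoc[symmetric] dest: C_closed)
    show "(\<otimes>) r ` {c \<in> C. c [^] p = \<one>} \<subseteq> {c \<in> C. c [^] p = d}"
    proof clarify
      fix c assume c: "c \<in> C" "c [^] p = \<one>"
      have "(r \<otimes> c) [^] p = d" using r(2) c(2) rc C_closed[OF c(1)] C_closed[OF d(1)]
        by (simp add: nat_pow_distrib)
      then show "r \<otimes> c \<in> C \<and> (r \<otimes> c) [^] p = d"
        using subgroup.m_closed[OF subgroup_C r(1) c(1)] by blast
    qed
    show "(\<otimes>) (inv r) ` {c \<in> C. c [^] p = d} \<subseteq> {c \<in> C. c [^] p = \<one>}"
    proof clarify
      fix c assume c: "c \<in> C" "d = c [^] p"
      have "(inv r \<otimes> c) [^] p = \<one>"
        using r(2) c(2) rc C_closed[OF c(1)] by (simp add: nat_pow_distrib nat_pow_inv)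
      then show "inv r \<otimes> c \<in> C \<and> (inv r \<otimes> c) [^] p = \<one>"
        using subgroup.m_closed[OF subgroup_C subgroup.m_inv_closed[OF subgroup_C r(1)] c(1)] by blast
    qed
  qed
  from bij_betw_same_card[OF this] show ?thesis by (simp add: card_kernel_power_p)
qed

section \<open>Counting homomorphisms into the cyclic group\<close>

text \<open>
  The condition at \<open>g\<close> makes \<open>x \<mapsto> x \<otimes> \<chi> x\<close> injective on \<open>C\<close>: it raises to a power whose exponent is
  congruent to 1 modulo \<open>p\<close>. Extensional functions are taken so that the set can be counted.
\<close>

definition characters where
  "characters H = {\<chi> \<in> H \<rightarrow>\<^sub>E C. (\<forall>x\<in>H. \<forall>y\<in>H. \<chi> (x \<otimes> y) = \<chi> x \<otimes> \<chi> y)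
     \<and> \<chi> g \<in> (\<lambda>c. c [^] p) ` C}"

lemma characters_mem: "\<chi> \<in> characters H \<Longrightarrow> x \<in> H \<Longrightarrow> \<chi> x \<in> C"
  by (auto simp: characters_def)

lemma characters_carrier: "\<chi> \<in> characters H \<Longrightarrow> x \<in> H \<Longrightarrow> \<chi> x \<in> carrier G"
  using characters_mem C_closed by blast

lemma characters_mult:
  "\<chi> \<in> characters H \<Longrightarrow> x \<in> H \<Longrightarrow> y \<in> H \<Longrightarrow> \<chi> (x \<otimes> y) = \<chi> x \<otimes> \<chi> y"
  by (auto simp: characters_def)

lemma characters_one:
  assumes "subgroup H G" "\<chi> \<in> characters H"
  shows "\<chi> \<one> = \<one>"
proof -
  have 1: "\<one> \<in> H" using assms subgroup.one_closed by blast
  have "\<chi> \<one> \<otimes> \<chi> \<one> = \<chi> \<one>" using characters_mult[OF assms(2) 1 1] by simp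
  then show ?thesis using characters_carrier[OF assms(2) 1] by (simp add: l_cancel_one)
qed

lemma characters_pow:
  assumes "subgroup H G" "\<chi> \<in> characters H" "x \<in> H"
  shows "\<chi> (x [^] (k::nat)) = \<chi> x [^] k"
  by (induction k) (use assms in \<open>auto simp: characters_one characters_mult pow_mem\<close>)

lemma finite_characters: "finite H \<Longrightarrow> finite (characters H)"
  using finite_PiE[of H "\<lambda>_. C"] finite_C by (auto simp: characters_def)

text \<open>
  A homomorphism on \<open>C\<close> is determined by its value at \<open>g\<close>, which may be any \<open>p\<close>-th power in \<open>C\<close>; the
  fibres of the \<open>p\<close>-th power map on \<open>C\<close> all have \<open>p\<close> elements.
\<close>

lemma card_characters_C: "p * card (characters C) = card C"
proof -
  define D where "D = (\<lambda>c. c [^] p) ` C"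
  have "card C = card (\<Union>d\<in>D. {c \<in> C. c [^] p = d})"
    by (rule arg_cong[where f = card]) (auto simp: D_def)
  also have "\<dots> = (\<Sum>d\<in>D. card {c \<in> C. c [^] p = d})"
    by (rule card_UN_disjoint) (auto simp: D_def finite_C)
  also have "\<dots> = (\<Sum>d\<in>D. p)"
  proof (rule sum.cong[OF refl], rule card_pth_roots)
    fix d assume "d \<in> D"
    then obtain c where c: "c \<in> C" "d = c [^] p" by (auto simp: D_def)
    show "d \<in> C" using c pow_mem[OF subgroup_C] by simp
    show "d [^] (p ^ e) = \<one>" using c C_pow_eq_one[OF c(1)] C_closed by (simp add: nat_pow_pow)
  qed
  finally have cC: "card C = p * card D" by simp
  have "bij_betw (\<lambda>\<chi>. \<chi> g) (characters C) D"
    unfolding bij_betw_def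
  proof (intro conjI inj_onI equalityI subsetI)
    fix \<chi> \<psi> assume \<chi>: "\<chi> \<in> characters C" and \<psi>: "\<psi> \<in> characters C" and eq: "\<chi> g = \<psi> g"
    show "\<chi> = \<psi>"
    proof (rule PiE_ext)
      show "\<chi> \<in> C \<rightarrow>\<^sub>E C" "\<psi> \<in> C \<rightarrow>\<^sub>E C" using \<chi> \<psi> by (auto simp: characters_def)
      fix x assume "x \<in> C"
      then obtain k :: nat where "x = g [^] k" by (auto simp: C_eq)
      then show "\<chi> x = \<psi> x"
        using eq characters_pow[OF subgroup_C \<chi> g_in_C] characters_pow[OF subgroup_C \<psi> g_in_C] by simp
    qed
  next
    fix d assume "d \<in> (\<lambda>\<chi>. \<chi> g) ` characters C"
    then show "d \<in> D" by (auto simp: characters_def D_def)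
  next
    fix d assume "d \<in> D"
    then obtain c where c: "c \<in> C" "d = c [^] p" by (auto simp: D_def)
    then obtain k :: nat where k: "c = g [^] k" by (auto simp: C_eq)
    define \<chi> where "\<chi> = restrict (\<lambda>x. x [^] (k * p)) C"
    have g: "\<chi> g = d" using k c g_in_C g_closed by (simp add: \<chi>_def nat_pow_pow)
    have "\<chi> \<in> characters C"
      unfolding characters_def
    proof (intro CollectI conjI ballI)
      show "\<chi> \<in> C \<rightarrow>\<^sub>E C" using pow_mem[OF subgroup_C] by (auto simp: \<chi>_def)
      show "\<chi> (x \<otimes> y) = \<chi> x \<otimes> \<chi> y" if "x \<in> C" "y \<in> C" for x y
        using that C_closed subgroup.m_closed[OF subgroup_C] by (simp add: \<chi>_def nat_pow_distrib)
      show "\<chi> g \<in> (\<lambda>c. c [^] p) ` C" using g c by simp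
    qed
    then show "d \<in> (\<lambda>\<chi>. \<chi> g) ` characters C" using g by blast
  qed
  from bij_betw_same_card[OF this] show ?thesis by (simp add: cC)
qed

text \<open>
  Every element of the larger group is \<open>h \<otimes> x [^] i\<close> with \<open>h\<close> in \<open>H\<close>, and the only relations between
  such expressions come from \<open>x [^] p\<close> being in \<open>H\<close>. Therefore the pairs \<open>(h, i)\<close> with \<open>i < p\<close> count the
  larger group, and a homomorphism on it amounts to its restriction to \<open>H\<close> together with its value at
  \<open>x\<close>, which can be any \<open>p\<close>-th root in \<open>C\<close> of the value prescribed at \<open>x [^] p\<close>.
\<close>

lemma card_characters_adjoin:
  assumes H: "subgroup H G" and CH: "C \<subseteq> H"
    and x: "x \<in> carrier G" "x \<notin> H" "x [^] p \<in> H" "x [^] (p ^ Suc e) = \<one>"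
  obtains H' where "subgroup H' G" "H' = {h \<otimes> x [^] (i::nat) | h i. h \<in> H}"
    "card H' = p * card H" "card (characters H') = p * card (characters H)"
proof -
  have p0: "p > 0" using prime_p prime_gt_0_nat by blast
  have Hc: "h \<in> carrier G" if "h \<in> H" for h using that H subgroup.mem_carrier by metis
  have finH: "finite H" using finite_carrier H by (meson finite_subset subgroup.subset)
  define H' where "H' = {h \<otimes> x [^] (i::nat) | h i. h \<in> H}"
  have gx: "generate G {x} = {x [^] (k::nat) | k. k \<in> UNIV}"
    using generate_pow_on_finite_carrier[OF finite_carrier x(1)] by auto
  have "H <#> generate G {x} = H'"
    unfolding gx H'_def set_mult_def by blast
  then have H': "subgroup H' G"
    using mult_subgroups[OF H generate_is_subgroup[of "{x}"]] x by auto
  have HH': "H \<subseteq> H'"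
  proof
    fix h assume h: "h \<in> H"
    then have "h = h \<otimes> x [^] (0::nat)" using Hc by simp
    with h show "h \<in> H'" unfolding H'_def by blast
  qed
  have xH': "x \<in> H'"
  proof -
    have "x = \<one> \<otimes> x [^] (1::nat)" using x by simp
    then show ?thesis unfolding H'_def using subgroup.one_closed[OF H] by blast
  qed
  have finH': "finite H'" using finite_carrier H' by (meson finite_subset subgroup.subset)
  have dvd: "p dvd k" if "x [^] (k::nat) \<in> H" for k
  proof (rule ccontr)
    assume "\<not> p dvd k"
    then have "coprime p k" using prime_p prime_imp_coprime by blast
    then show False using coprime_pow_mem_imp_mem[OF H x(1) x(3) that] x(2) by simp
  qed
  \<comment> \<open>Two expressions of the same element differ by moving powers of \<open>x [^] p\<close> into \<open>H\<close>.\<close>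
  have diff: "\<exists>k. j = i + p * k \<and> h = h' \<otimes> (x [^] p) [^] k"
    if "h \<in> H" "h' \<in> H" "h \<otimes> x [^] (i::nat) = h' \<otimes> x [^] j" "i \<le> j" for h h' and i j :: nat
  proof -
    have "h \<otimes> x [^] i = (h' \<otimes> x [^] (j - i)) \<otimes> x [^] i"
      using that x Hc by (simp add: m_assoc nat_pow_mult)
    then have h: "h = h' \<otimes> x [^] (j - i)"
      using that x Hc by (metis m_closed nat_pow_closed r_cancel)
    then have "inv h' \<otimes> h = x [^] (j - i)"
      using that x Hc by (simp add: m_assoc[symmetric])
    then have "x [^] (j - i) \<in> H"
      using that H by (metis subgroup.m_closed subgroup.m_inv_closed)
    then obtain k where "j - i = p * k" using dvd by blast
    then show ?thesis using h that(4) x by (intro exI[of _ k]) (auto simp: nat_pow_pow)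
  qed
  have cardH': "card H' = p * card H"
  proof -
    have "bij_betw (\<lambda>(h, i). h \<otimes> x [^] i) (H \<times> {..<p}) H'"
      unfolding bij_betw_def
    proof
      have le: "h = h' \<and> i = j" if "h \<in> H" "h' \<in> H" "j < p"
        "h \<otimes> x [^] (i::nat) = h' \<otimes> x [^] j" "i \<le> j" for h h' and i j :: nat
      proof -
        from diff[OF that(1,2,4,5)] obtain k where k: "j = i + p * k" "h = h' \<otimes> (x [^] p) [^] k"
          by blast
        then have "k = 0" using that(3) by (cases k) auto
        then show ?thesis using k Hc that by simp
      qed
      show "inj_on (\<lambda>(h, i). h \<otimes> x [^] i) (H \<times> {..<p})"
      proof (rule inj_onI, clarsimp)
        fix h i h' j assume A: "h \<in> H" "i < p" "h' \<in> H" "j < p" "h \<otimes> x [^] i = h' \<otimes> x [^] j"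
        show "h = h' \<and> i = j"
        proof (cases "i \<le> j")
          case True
          then show ?thesis using le[of h h' j i] A by simp
        next
          case False
          then show ?thesis using le[of h' h i j] A by simp
        qed
      qed
      show "(\<lambda>(h, i). h \<otimes> x [^] i) ` (H \<times> {..<p}) = H'"
      proof (intro equalityI subsetI)
        fix y assume "y \<in> (\<lambda>(h, i). h \<otimes> x [^] i) ` (H \<times> {..<p})"
        then show "y \<in> H'" unfolding H'_def by auto
      next
        fix y assume "y \<in> H'"
        then obtain h and i :: nat where hi: "h \<in> H" "y = h \<otimes> x [^] i" unfolding H'_def by auto
        have "x [^] i = x [^] (p * (i div p)) \<otimes> x [^] (i mod p)"
          using x by (simp add: nat_pow_mult)
        then have "y = (h \<otimes> (x [^] p) [^] (i div p)) \<otimes> x [^] (i mod p)"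
          using hi x Hc by (simp add: m_assoc nat_pow_pow)
        moreover have "h \<otimes> (x [^] p) [^] (i div p) \<in> H"
          using hi x H by (simp add: pow_mem subgroup.m_closed)
        ultimately show "y \<in> (\<lambda>(h, i). h \<otimes> x [^] i) ` (H \<times> {..<p})"
          using p0 by (intro image_eqI[of _ _ "(h \<otimes> (x [^] p) [^] (i div p), i mod p)"]) auto
      qed
    qed
    from bij_betw_same_card[OF this] show ?thesis by (simp add: card_cartesian_product mult.commute)
  qed
  let ?R = "\<lambda>\<chi>. {c \<in> C. c [^] p = \<chi> (x [^] p)}"
  have "bij_betw (\<lambda>\<psi>. (restrict \<psi> H, \<psi> x)) (characters H') (SIGMA \<chi>:characters H. ?R \<chi>)"
    unfolding bij_betw_def
  proof (intro conjI inj_onI equalityI subsetI)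
    fix \<psi> \<phi> assume \<psi>: "\<psi> \<in> characters H'" and \<phi>: "\<phi> \<in> characters H'"
      and eq: "(restrict \<psi> H, \<psi> x) = (restrict \<phi> H, \<phi> x)"
    show "\<psi> = \<phi>"
    proof (rule PiE_ext)
      show "\<psi> \<in> H' \<rightarrow>\<^sub>E C" "\<phi> \<in> H' \<rightarrow>\<^sub>E C" using \<psi> \<phi> by (auto simp: characters_def)
      fix y assume "y \<in> H'"
      then obtain h and i :: nat where hi: "h \<in> H" "y = h \<otimes> x [^] i" unfolding H'_def by auto
      have "\<psi> h = \<phi> h" using eq hi(1) by (metis prod.inject restrict_apply')
      moreover have "h \<in> H'" "x [^] i \<in> H'" using hi HH' pow_mem[OF H' xH'] by auto
      ultimately show "\<psi> y = \<phi> y"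
        using eq hi characters_mult[OF \<psi>] characters_mult[OF \<phi>]
          characters_pow[OF H' \<psi> xH'] characters_pow[OF H' \<phi> xH'] by simp
    qed
  next
    fix z assume "z \<in> (\<lambda>\<psi>. (restrict \<psi> H, \<psi> x)) ` characters H'"
    then obtain \<psi> where \<psi>: "\<psi> \<in> characters H'" and z: "z = (restrict \<psi> H, \<psi> x)" by blast
    have "restrict \<psi> H \<in> characters H"
      unfolding characters_def
    proof (intro CollectI conjI ballI)
      show "restrict \<psi> H \<in> H \<rightarrow>\<^sub>E C"
        using HH' characters_mem[OF \<psi>] by auto
      show "restrict \<psi> H (y \<otimes> z) = restrict \<psi> H y \<otimes> restrict \<psi> H z"
        if "y \<in> H" "z \<in> H" for y z
        using that subgroup.m_closed[OF H] characters_mult[OF \<psi>, of y z] HH' by auto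
      show "restrict \<psi> H g \<in> (\<lambda>c. c [^] p) ` C"
        using \<psi> CH g_in_C by (auto simp: characters_def)
    qed
    moreover have "\<psi> x \<in> ?R (restrict \<psi> H)"
      using characters_mem[OF \<psi> xH'] characters_pow[OF H' \<psi> xH'] x(3) by simp
    ultimately show "z \<in> (SIGMA \<chi>:characters H. ?R \<chi>)" using z by blast
  next
    fix z assume "z \<in> (SIGMA \<chi>:characters H. ?R \<chi>)"
    then obtain \<chi> c where \<chi>: "\<chi> \<in> characters H" and c: "c \<in> C" "c [^] p = \<chi> (x [^] p)"
      and z: "z = (\<chi>, c)" by blast
    note cc = C_closed[OF c(1)]
    have wd: "\<chi> h \<otimes> c [^] i = \<chi> h' \<otimes> c [^] j"
      if "h \<in> H" "h' \<in> H" "h \<otimes> x [^] (i::nat) = h' \<otimes> x [^] j" "i \<le> j" for h h' and i j :: nat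
    proof -
      from diff[OF that] obtain k where k: "j = i + p * k" "h = h' \<otimes> (x [^] p) [^] k"
        by blast
      have "\<chi> h = \<chi> h' \<otimes> (c [^] p) [^] k"
        using k(2) that(2) x(3) c \<chi> H by (simp add: characters_mult characters_pow pow_mem)
      then show ?thesis using k(1) cc characters_carrier[OF \<chi> that(2)]
        by (simp add: nat_pow_pow m_assoc nat_pow_mult add.commute)
    qed
    \<comment> \<open>By \<open>wd\<close>, any choice of an expression \<open>h \<otimes> x [^] i\<close> of \<open>y\<close> gives the same value of the extension.\<close>
    define pick where "pick y = (SOME q. fst q \<in> H \<and> y = fst q \<otimes> x [^] (snd q :: nat))" for y
    define \<psi> where "\<psi> = restrict (\<lambda>y. \<chi> (fst (pick y)) \<otimes> c [^] snd (pick y)) H'"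
    have \<psi>: "\<psi> (h \<otimes> x [^] i) = \<chi> h \<otimes> c [^] i" if h: "h \<in> H" for h and i :: nat
    proof -
      let ?y = "h \<otimes> x [^] i"
      have "\<exists>q. fst q \<in> H \<and> ?y = fst q \<otimes> x [^] (snd q :: nat)"
        using h by (intro exI[of _ "(h, i)"]) simp
      then have P: "fst (pick ?y) \<in> H" "?y = fst (pick ?y) \<otimes> x [^] snd (pick ?y)"
        unfolding pick_def by (metis (mono_tags, lifting) someI_ex)+
      have "?y \<in> H'" using h unfolding H'_def by blast
      then have "\<psi> ?y = \<chi> (fst (pick ?y)) \<otimes> c [^] snd (pick ?y)" by (simp add: \<psi>_def)
      also have "\<dots> = \<chi> h \<otimes> c [^] i"
        using wd[OF h P(1) P(2)] wd[OF P(1) h P(2)[symmetric]]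
        by (cases "i \<le> snd (pick ?y)") auto
      finally show ?thesis .
    qed
    have \<psi>H: "\<psi> h = \<chi> h" if "h \<in> H" for h
      using \<psi>[OF that, of 0] that Hc characters_carrier[OF \<chi> that] by simp
    have \<psi>x: "\<psi> x = c"
      using \<psi>[OF subgroup.one_closed[OF H], of 1] x cc characters_one[OF H \<chi>] by simp
    have "\<psi> \<in> characters H'"
      unfolding characters_def
    proof (intro CollectI conjI ballI)
      show "\<psi> \<in> H' \<rightarrow>\<^sub>E C"
      proof (rule PiE_I)
        fix y assume "y \<in> H'"
        then obtain h and i :: nat where hi: "h \<in> H" "y = h \<otimes> x [^] i" unfolding H'_def by auto
        then show "\<psi> y \<in> C"
          using \<psi> c characters_mem[OF \<chi>] subgroup_C by (simp add: pow_mem subgroup.m_closed)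
      qed (simp add: \<psi>_def)
      show "\<psi> (y \<otimes> z) = \<psi> y \<otimes> \<psi> z" if "y \<in> H'" "z \<in> H'" for y z
      proof -
        obtain h and i :: nat where hi: "h \<in> H" "y = h \<otimes> x [^] i"
          using \<open>y \<in> H'\<close> unfolding H'_def by auto
        obtain h' and j :: nat where hj: "h' \<in> H" "z = h' \<otimes> x [^] j"
          using \<open>z \<in> H'\<close> unfolding H'_def by auto
        have "y \<otimes> z = (h \<otimes> h') \<otimes> x [^] (i + j)"
          using hi hj x Hc by (simp add: nat_pow_mult[symmetric] m_ac)
        then have "\<psi> (y \<otimes> z) = (\<chi> h \<otimes> \<chi> h') \<otimes> c [^] (i + j)"
          using hi hj \<psi> subgroup.m_closed[OF H] characters_mult[OF \<chi>] by simp
        then show ?thesis using hi hj \<psi> cc characters_carrier[OF \<chi>]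
          by (simp add: nat_pow_mult[symmetric] m_ac)
      qed
      show "\<psi> g \<in> (\<lambda>c. c [^] p) ` C"
        using \<psi>H[of g] CH g_in_C \<chi> by (auto simp: characters_def)
    qed
    moreover have "restrict \<psi> H = \<chi>"
      using \<psi>H \<chi> by (auto simp: characters_def intro!: PiE_ext[of _ H "\<lambda>_. C"])
    ultimately show "z \<in> (\<lambda>\<psi>. (restrict \<psi> H, \<psi> x)) ` characters H'"
      using z \<psi>x by (intro image_eqI[of _ _ \<psi>]) auto
  qed
  then have "card (characters H') = card (SIGMA \<chi>:characters H. ?R \<chi>)"
    by (rule bij_betw_same_card)
  also have "\<dots> = (\<Sum>\<chi>\<in>characters H. card (?R \<chi>))"
    by (rule card_SigmaI) (auto simp: finite_characters finH finite_C)
  also have "\<dots> = (\<Sum>\<chi>\<in>characters H. p)"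
  proof (rule sum.cong[OF refl], rule card_pth_roots)
    fix \<chi> assume \<chi>: "\<chi> \<in> characters H"
    show "\<chi> (x [^] p) \<in> C" using characters_mem[OF \<chi> x(3)] .
    have "\<chi> (x [^] p) [^] (p ^ e) = \<chi> (x [^] (p ^ Suc e))"
      using characters_pow[OF H \<chi> x(3)] x(1) by (simp add: nat_pow_pow)
    then show "\<chi> (x [^] p) [^] (p ^ e) = \<one>" using x(4) characters_one[OF H \<chi>] by simp
  qed
  finally have "card (characters H') = p * card (characters H)" by simp
  with H' cardH' show thesis using that H'_def by blast
qed

text \<open>
  The equation holds for \<open>C\<close>. It holds for all of \<open>P\<close> because a largest subgroup satisfying it cannot be
  proper: the last \<open>p\<close>-power of an outside element that still lies outside can be adjoined.
\<close>

lemma card_characters: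
  assumes P: "subgroup P G" and CP: "C \<subseteq> P"
    and exp: "\<And>x. x \<in> P \<Longrightarrow> x [^] (p ^ Suc e) = \<one>"
  shows "p * card (characters P) = card P"
proof -
  let ?S = "{H. subgroup H G \<and> C \<subseteq> H \<and> H \<subseteq> P \<and> p * card (characters H) = card H}"
  have "?S \<subseteq> Pow (carrier G)" using subgroup.subset by auto
  then have "finite ?S" using finite_carrier by (meson finite_Pow_iff finite_subset)
  moreover have "C \<in> ?S" using subgroup_C CP card_characters_C by simp
  ultimately obtain M where M: "M \<in> ?S" and max: "\<And>H. H \<in> ?S \<Longrightarrow> M \<subseteq> H \<Longrightarrow> M = H"
    using finite_has_maximal[of ?S] by (metis (lifting) empty_iff)
  have "M = P"
  proof (rule ccontr)
    assume "M \<noteq> P"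
    then obtain y where y: "y \<in> P" "y \<notin> M" using M by blast
    have yc: "y \<in> carrier G" using y P subgroup.mem_carrier by metis
    define i where "i = (LEAST i. y [^] (p ^ i) \<in> M)"
    have "y [^] (p ^ Suc e) \<in> M" using exp[OF y(1)] M subgroup.one_closed by auto
    then have i: "y [^] (p ^ i) \<in> M" unfolding i_def by (rule LeastI)
    have "i \<noteq> 0" using i y yc by (metis nat_pow_eone power_0)
    then obtain j where j: "i = Suc j" using not0_implies_Suc by blast
    define x where "x = y [^] (p ^ j)"
    have x: "x \<in> P" "x \<in> carrier G" using y yc pow_mem[OF P] by (auto simp: x_def)
    have xM: "x \<notin> M" using not_less_Least[of j "\<lambda>i. y [^] (p ^ i) \<in> M"] j by (auto simp: i_def x_def)
    have xp: "x [^] p \<in> M" using i j yc by (simp add: x_def nat_pow_pow mult.commute)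
    have M': "subgroup M G" "C \<subseteq> M" using M by auto
    obtain H' where H': "subgroup H' G" "H' = {h \<otimes> x [^] (i::nat) | h i. h \<in> M}"
      "card H' = p * card M" "card (characters H') = p * card (characters M)"
      by (rule card_characters_adjoin[OF M' x(2) xM xp exp[OF x(1)]])
    have Mc: "h \<in> carrier G" if "h \<in> M" for h using subgroup.mem_carrier[OF M'(1) that] .
    have MH': "M \<subseteq> H'"
    proof
      fix h assume h: "h \<in> M"
      then have "h = h \<otimes> x [^] (0::nat)" using Mc by simp
      with h show "h \<in> H'" unfolding H'(2) by blast
    qed
    have "\<one> \<otimes> x [^] (1::nat) \<in> H'" unfolding H'(2) using subgroup.one_closed[OF M'(1)] by blast
    then have "x \<in> H'" using x by simp
    have "H' \<subseteq> P"
    proof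
      fix z assume "z \<in> H'"
      then obtain h and i :: nat where "h \<in> M" "z = h \<otimes> x [^] i" unfolding H'(2) by auto
      moreover have "h \<in> P" using \<open>h \<in> M\<close> M by blast
      ultimately show "z \<in> P" using subgroup.m_closed[OF P _ pow_mem[OF P x(1)]] by simp
    qed
    moreover have "p * card (characters H') = card H'" using H'(3,4) M by simp
    ultimately have "H' \<in> ?S" using H'(1) MH' M'(2) by simp
    from max[OF this MH'] show False using \<open>x \<in> H'\<close> xM by simp
  qed
  then show ?thesis using M by simp
qed


section \<open>The automorphisms given by these homomorphisms\<close>

definition shear where
  "shear m \<chi> = (\<lambda>x\<in>carrier G. x \<otimes> \<chi> (x [^] (m::nat)))"

text \<open>
  The hypotheses on \<open>m\<close> say that \<open>x \<mapsto> x [^] m\<close> is a retraction of \<open>G\<close> onto \<open>P\<close>. The composite of the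
  maps given by \<open>\<chi>\<close> and \<open>\<psi>\<close> is the map given by \<open>y \<mapsto> \<psi> y \<otimes> \<chi> y \<otimes> \<chi> (\<psi> y)\<close>, so these maps
  are closed under composition, and different homomorphisms give different maps because the retraction
  is the identity on \<open>P\<close>.
\<close>

lemma card_characters_dvd_order_AutoGroup:
  assumes P: "subgroup P G" and CP: "C \<subseteq> P"
    and m: "\<And>x. x \<in> carrier G \<Longrightarrow> x [^] (m::nat) \<in> P" "\<And>x. x \<in> P \<Longrightarrow> x [^] m = x"
  shows "card (characters P) dvd order (AutoGroup G)"
proof -
  have Pc: "x \<in> carrier G" if "x \<in> P" for x using that P subgroup.mem_carrier by metis
  have val: "\<chi> (x [^] m) \<in> carrier G" "\<chi> (x [^] m) \<in> C"
    if "\<chi> \<in> characters P" "x \<in> carrier G" for \<chi> x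
    using that m characters_carrier characters_mem by blast+
  have hom: "shear m \<chi> \<in> hom G G" if \<chi>: "\<chi> \<in> characters P" for \<chi>
  proof (rule homI)
    show "shear m \<chi> x \<in> carrier G" if "x \<in> carrier G" for x
      using that val[OF \<chi>] by (simp add: shear_def)
    show "shear m \<chi> (x \<otimes> y) = shear m \<chi> x \<otimes> shear m \<chi> y"
      if "x \<in> carrier G" "y \<in> carrier G" for x y
      using that val[OF \<chi>] m(1) by (simp add: shear_def nat_pow_distrib characters_mult[OF \<chi>] m_ac)
  qed
  have inj: "inj_on (shear m \<chi>) (carrier G)" if \<chi>: "\<chi> \<in> characters P" for \<chi>
  proof -
    interpret \<phi>: group_hom G G "shear m \<chi>"
      using hom[OF \<chi>] by unfold_locales
    have "x = \<one>" if x: "x \<in> carrier G" and one: "shear m \<chi> x = \<one>" for x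
    proof -
      \<comment> \<open>An element of the kernel is inverse to a value of \<open>\<chi>\<close>, so it is a power of \<open>g\<close>.\<close>
      have eq: "x \<otimes> \<chi> (x [^] m) = \<one>" using x one by (simp add: shear_def)
      then have "x = inv (\<chi> (x [^] m))" using x val[OF \<chi> x] inv_equality[of x "\<chi> (x [^] m)"] by simp
      then have xC: "x \<in> C" using subgroup.m_inv_closed[OF subgroup_C val(2)[OF \<chi> x]] by metis
      then obtain k :: nat where k: "x = g [^] k" by (auto simp: C_eq)
      obtain c where "c \<in> C" "\<chi> g = c [^] p" using \<chi> by (auto simp: characters_def)
      then obtain j :: nat where j: "\<chi> g = (g [^] j) [^] p" by (auto simp: C_eq)
      have "\<chi> (x [^] m) = \<chi> x" using m(2) xC CP by auto
      also have "\<dots> = (\<chi> g) [^] k" using k characters_pow[OF P \<chi>] CP g_in_C by blast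
      also have "\<dots> = g [^] (k * (p * j))" using j g_closed by (simp add: nat_pow_pow mult_ac)
      finally have "g [^] (k * (p * j + 1)) = \<one>"
        using eq k g_closed by (simp add: nat_pow_mult algebra_simps)
      then have "p ^ Suc e dvd k * (p * j + 1)" by (simp only: g_pow_eq_one_iff)
      moreover have "coprime (p ^ Suc e) (p * j + 1)"
        using coprime_add_one_right[of "p * j"] by (simp only: coprime_power_left_iff coprime_mult_left_iff simp_thms)
      ultimately have "p ^ Suc e dvd k" using coprime_dvd_mult_left_iff by blast
      then show "x = \<one>" using k g_pow_eq_one_iff by simp
    qed
    then show ?thesis using \<phi>.inj_on_one_iff by blast
  qed
  have auto_mem: "shear m \<chi> \<in> auto G" if \<chi>: "\<chi> \<in> characters P" for \<chi>
  proof -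
    have "shear m \<chi> ` carrier G \<subseteq> carrier G" using hom[OF \<chi>] by (auto simp: hom_def)
    then have "bij_betw (shear m \<chi>) (carrier G) (carrier G)"
      using inj[OF \<chi>] finite_carrier endo_inj_surj unfolding bij_betw_def by blast
    then show ?thesis using hom[OF \<chi>] by (simp add: auto_def Bij_def shear_def)
  qed
  have comp: "compose (carrier G) (shear m \<chi>) (shear m \<psi>) \<in> shear m ` characters P"
    if \<chi>: "\<chi> \<in> characters P" and \<psi>: "\<psi> \<in> characters P" for \<chi> \<psi>
  proof -
    define \<omega> where "\<omega> = (\<lambda>y\<in>P. \<psi> y \<otimes> \<chi> y \<otimes> \<chi> (\<psi> y))"
    have \<psi>P: "\<psi> y \<in> P" if "y \<in> P" for y using characters_mem[OF \<psi> that] CP by blast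
    have gP: "g \<in> P" using CP g_in_C by blast
    have "\<omega> \<in> characters P"
      unfolding characters_def
    proof (intro CollectI conjI ballI)
      show "\<omega> \<in> P \<rightarrow>\<^sub>E C"
        using characters_mem[OF \<chi>] characters_mem[OF \<psi>] \<psi>P subgroup.m_closed[OF subgroup_C]
        by (auto simp: \<omega>_def)
      show "\<omega> (x \<otimes> y) = \<omega> x \<otimes> \<omega> y" if "x \<in> P" "y \<in> P" for x y
        using that \<psi>P characters_carrier[OF \<chi>] characters_carrier[OF \<psi>] subgroup.m_closed[OF P]
        by (simp add: \<omega>_def characters_mult[OF \<chi>] characters_mult[OF \<psi>] m_ac)
      obtain a where a: "a \<in> C" "\<chi> g = a [^] p" using \<chi> by (auto simp: characters_def)
      obtain b where b: "b \<in> C" "\<psi> g = b [^] p" using \<psi> by (auto simp: characters_def)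
      have bP: "b \<in> P" using b CP by blast
      have "\<omega> g = b [^] p \<otimes> a [^] p \<otimes> \<chi> b [^] p"
        using gP a b characters_pow[OF P \<chi> bP] by (simp add: \<omega>_def)
      also have "\<dots> = (b \<otimes> a \<otimes> \<chi> b) [^] p"
        using a b C_closed characters_carrier[OF \<chi> bP] by (simp add: nat_pow_distrib)
      finally show "\<omega> g \<in> (\<lambda>c. c [^] p) ` C"
        using a b characters_mem[OF \<chi> bP] subgroup.m_closed[OF subgroup_C] by blast
    qed
    moreover have "compose (carrier G) (shear m \<chi>) (shear m \<psi>) = shear m \<omega>"
    proof (rule extensionalityI[of _ "carrier G"])
      fix x assume x: "x \<in> carrier G"
      let ?y = "x [^] m"
      have y: "?y \<in> P" using m(1) x .
      have "(x \<otimes> \<psi> ?y) [^] m = ?y \<otimes> \<psi> ?y"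
        using x val[OF \<psi> x] m(2)[OF \<psi>P[OF y]] by (simp add: nat_pow_distrib)
      then show "compose (carrier G) (shear m \<chi>) (shear m \<psi>) x = shear m \<omega> x"
        using x y val[OF \<psi> x] val[OF \<chi> x] \<psi>P[OF y] characters_carrier[OF \<chi> \<psi>P[OF y]]
        by (simp add: compose_def shear_def \<omega>_def characters_mult[OF \<chi>] m_ac)
    qed (auto simp: compose_def shear_def)
    ultimately show ?thesis by blast
  qed
  interpret A: group "AutoGroup G" by (rule AutoGroup)
  have carrier_A: "carrier (AutoGroup G) = auto G" by (simp add: AutoGroup_def)
  have mult_A: "\<alpha> \<otimes>\<^bsub>AutoGroup G\<^esub> \<beta> = compose (carrier G) \<alpha> \<beta>"
    if "\<alpha> \<in> auto G" "\<beta> \<in> auto G" for \<alpha> \<beta>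
    using that by (simp add: AutoGroup_def BijGroup_def auto_def)
  have finP: "finite P" using finite_carrier P by (meson finite_subset subgroup.subset)
  have "restrict (\<lambda>_. \<one>) P \<in> characters P"
    using P CP g_in_C subgroup.one_closed[OF subgroup_C] subgroup.m_closed[OF P]
    by (auto simp: characters_def image_iff intro!: bexI[of _ \<one>])
  then have "subgroup (shear m ` characters P) (AutoGroup G)"
    using auto_mem comp finite_characters[OF finP]
    by (intro A.subgroup_of_finite_closed) (auto simp: carrier_A mult_A)
  moreover have "inj_on (shear m) (characters P)"
  proof (rule inj_onI)
    fix \<chi> \<psi> assume \<chi>: "\<chi> \<in> characters P" and \<psi>: "\<psi> \<in> characters P"
      and eq: "shear m \<chi> = shear m \<psi>"
    show "\<chi> = \<psi>"
    proof (rule PiE_ext)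
      show "\<chi> \<in> P \<rightarrow>\<^sub>E C" "\<psi> \<in> P \<rightarrow>\<^sub>E C" using \<chi> \<psi> by (auto simp: characters_def)
      fix x assume x: "x \<in> P"
      have "x \<otimes> \<chi> x = x \<otimes> \<psi> x"
        using fun_cong[OF eq, of x] x Pc m(2)[OF x] by (simp add: shear_def)
      then show "\<chi> x = \<psi> x"
        using x Pc characters_carrier[OF \<chi> x] characters_carrier[OF \<psi> x] by simp
    qed
  qed
  ultimately show ?thesis
    using A.lagrange by (metis card_image dvd_triv_right)
qed

end

section \<open>The denominator of the ratio\<close>

text \<open>
  The \<open>p\<close>-part \<open>P\<close> is the kernel of the power map with exponent \<open>p ^ N\<close>, the full power of \<open>p\<close> in \<open>|G|\<close>;
  it contains a Sylow subgroup, so \<open>p ^ N\<close> divides its order. An element of \<open>P\<close> of largest order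
  can serve as \<open>g\<close>: the orders in \<open>P\<close> are powers of \<open>p\<close>, so they all divide the largest one.
\<close>

lemma (in comm_group) prime_power_dvd_order_AutoGroup:
  assumes fin: "finite (carrier G)" and p: "Factorial_Ring.prime (p::nat)"
    and dvd: "p ^ Suc n dvd order G"
  shows "p ^ n dvd order (AutoGroup G)"
proof -
  have p0: "p > 0" using p prime_gt_0_nat by blast
  have ord0: "order G \<noteq> 0" using fin order_gt_0_iff_finite by simp
  define N where "N = multiplicity p (order G)"
  have "\<not> is_unit p" using p by (metis not_prime_unit)
  then have nN: "Suc n \<le> N" using dvd ord0
    unfolding N_def by (intro multiplicity_geI) auto
  obtain r where r: "order G = p ^ N * r" "\<not> p dvd r"
    using multiplicity_decompose'[of "order G" p] ord0 \<open>\<not> is_unit p\<close> unfolding N_def by auto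
  define P where "P = {x \<in> carrier G. x [^] (p ^ N) = \<one>}"
  have P: "subgroup P G"
    by (rule subgroupI) (auto simp: P_def nat_pow_inv nat_pow_distrib)
  obtain S where S: "subgroup S G" "card S = p ^ N"
    using sylow_thm[OF p is_group r(1) fin] by blast
  have "S \<subseteq> P"
  proof
    fix x assume x: "x \<in> S"
    have "x [^]\<^bsub>G\<lparr>carrier := S\<rparr>\<^esub> order (G\<lparr>carrier := S\<rparr>) = \<one>"
      using group.pow_order_eq_1[OF subgroup_imp_group[OF S(1)], of x] x by simp
    then have "x [^] (p ^ N) = \<one>"
      using S(2) by (simp only: nat_pow_consistent[symmetric]) (simp add: order_def)
    moreover have "x \<in> carrier G" using x S subgroup.mem_carrier by metis
    ultimately show "x \<in> P" by (simp add: P_def)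
  qed
  then have "subgroup S (G\<lparr>carrier := P\<rparr>)"
    using subgroup_incl[OF S(1) P] by simp
  then have "card (rcosets\<^bsub>G\<lparr>carrier := P\<rparr>\<^esub> S) * card S = card P"
    using group.lagrange[OF subgroup_imp_group[OF P]] by (simp add: order_def)
  then have card_P: "p ^ N dvd card P" using S(2) by (metis dvd_triv_right)
  have finP: "finite P" using fin by (simp add: P_def)
  have ord_P: "\<exists>i. ord x = p ^ i" if "x \<in> P" for x
    using that p by (auto simp: P_def pow_eq_id divides_primepow_nat)
  have "finite (ord ` P)" "ord ` P \<noteq> {}" using finP P subgroup.one_closed by auto
  then obtain g where g: "g \<in> P" "\<And>x. x \<in> P \<Longrightarrow> ord x \<le> ord g"
    using Max_in[of "ord ` P"] Max_ge[of "ord ` P"] by fastforce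
  obtain d where d: "ord g = p ^ d" using ord_P g by blast
  have exp: "x [^] (p ^ d) = \<one>" if "x \<in> P" for x
  proof -
    obtain i where i: "ord x = p ^ i" using ord_P \<open>x \<in> P\<close> by blast
    then have "i \<le> d" using g(2)[OF that] d prime_gt_1_nat[OF p] by simp
    then show ?thesis using i that by (simp add: pow_eq_id P_def le_imp_power_dvd)
  qed
  have "d \<noteq> 0"
  proof
    assume "d = 0"
    then have "P = {\<one>}" using exp P subgroup.one_closed[OF P] by (auto simp: P_def)
    then have "p ^ N dvd 1" using card_P by simp
    then show False using nN p prime_gt_1_nat[OF p] by (simp add: nat_dvd_1_iff_1)
  qed
  then obtain e where e: "d = Suc e" using not0_implies_Suc by blast
  have gc: "g \<in> carrier G" using g by (simp add: P_def)
  interpret cyclic_p_subgroup G p e g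
    by unfold_locales (use fin p gc d e in auto)
  have CP: "C \<subseteq> P" using generate_subgroup_incl[of "{g}" P] g P by simp
  have "coprime r (p ^ N)" using r(2) p by (simp add: prime_imp_coprime coprime_commute)
  moreover have "r \<noteq> 0" using r(1) ord0 by auto
  \<comment> \<open>The exponent \<open>r * u\<close> is 1 modulo \<open>p ^ N\<close> and a multiple of the \<open>p\<close>-free part of \<open>|G|\<close>: it projects onto \<open>P\<close>.\<close>
  ultimately obtain u v where uv: "r * u = p ^ N * v + 1"
    using bezout_nat[of r "p ^ N"] by auto
  have "card (characters P) dvd order (AutoGroup G)"
  proof (rule card_characters_dvd_order_AutoGroup[OF P CP, of "r * u"])
    fix x assume x: "x \<in> carrier G"
    have "x [^] (r * u * p ^ N) = (x [^] order G) [^] u"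
      using x r(1) by (simp add: nat_pow_pow mult_ac)
    then show "x [^] (r * u) \<in> P" using x pow_order_eq_1[OF x] by (simp add: P_def nat_pow_pow)
  next
    fix x assume x: "x \<in> P"
    then have "x [^] (p ^ N * v) = \<one>" by (simp add: P_def nat_pow_pow[symmetric])
    then show "x [^] (r * u) = x" using x uv by (simp add: P_def)
  qed
  moreover have "p ^ n dvd card (characters P)"
  proof -
    have "p * card (characters P) = card P"
      using card_characters[OF P CP] exp e by simp
    then have "p ^ Suc n dvd p * card (characters P)"
      using card_P nN by (metis dvd_trans le_imp_power_dvd)
    then show ?thesis using p0 by simp
  qed
  ultimately show ?thesis by (rule dvd_trans[rotated])
qed

theorem theorem1:
  fixes G :: "('g, 'm) monoid_scheme" and a b :: int
  assumes "comm_group G"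
    and "finite (carrier G)"
    and "coprime a b"
    and "b \<noteq> 0"
    and "(of_nat (order (AutoGroup G)) / of_nat (order G) :: rat) = of_int a / of_int b"
  shows "squarefree b"
proof (rule ccontr)
  interpret comm_group G by fact
  have ord0: "order G \<noteq> 0" using assms(2) order_gt_0_iff_finite by simp
  have "of_int (int (order (AutoGroup G)) * b) = (of_int (a * int (order G)) :: rat)"
    using assms(4,5) ord0 by (simp add: field_simps)
  then have eq: "int (order (AutoGroup G)) * b = a * int (order G)"
    by (simp only: of_int_eq_iff)
  assume "\<not> squarefree b"
  then obtain q where q: "Factorial_Ring.prime q" "q\<^sup>2 dvd b"
    using squarefree_factorial_semiring[OF assms(4)] by blast
  define p where "p = nat q"
  have qp: "q = int p" using prime_ge_0_int[OF q(1)] by (simp add: p_def)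
  have p: "Factorial_Ring.prime p" using q(1) qp by simp
  define N where "N = multiplicity p (order G)"
  have "p ^ N dvd order G" unfolding N_def by (rule multiplicity_dvd)
  \<comment> \<open>For \<open>N = 0\<close> the truncated exponent is 0 and the claim is trivial; \<open>N - 1 + 2\<close> still exceeds \<open>N\<close>.\<close>
  then have "p ^ (N - 1) dvd order (AutoGroup G)"
    using prime_power_dvd_order_AutoGroup[OF assms(2) p, of "N - 1"] by (cases N) auto
  then have "int p ^ (N - 1) * int p ^ 2 dvd int (order (AutoGroup G)) * b"
    using q(2) qp by (intro mult_dvd_mono) (auto simp flip: of_nat_power)
  moreover have "int p ^ Suc N dvd int p ^ (N - 1) * int p ^ 2"
    unfolding power_add[symmetric] by (rule le_imp_power_dvd) simp
  ultimately have "int p ^ Suc N dvd a * int (order G)"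
    using eq dvd_trans by metis
  moreover have "coprime (int p ^ Suc N) a"
  proof -
    have "int p dvd b" using q(2) qp by (metis dvd_trans dvd_triv_left power2_eq_square)
    then have "coprime a (int p)" using assms(3) coprime_divisors[of a a "int p" b] by simp
    then show ?thesis by (simp add: coprime_commute)
  qed
  ultimately have "int p ^ Suc N dvd int (order G)"
    using coprime_dvd_mult_right_iff by blast
  then have "p ^ Suc N dvd order G" by (simp only: flip: of_nat_power int_dvd_int_iff)
  moreover have "\<not> is_unit p" using p by (metis not_prime_unit)
  ultimately have "Suc N \<le> N"
    unfolding N_def using ord0 by (intro multiplicity_geI) auto
  then show False by simp
qed

end
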